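(* Let $Q_2(x)=(1-|x|)\chi_{[-1,1]}(x)$ be the second order B-spline, i.e. $Q_2=Q_1*Q_1$ with $Q_1=\chi_{[-1/2,1/2]}$. For $g\in L^2(\mathbb{R})$ and $a,b>0$ let $\mathcal{G}(g,a,b)=\{e^{2\pi i b j\cdot}g(\cdot-a l): l,j\in\mathbb{Z}\}$. (i) Let $k,m\in\mathbb{N}$ with $k>m$, put $a_0=\frac{1}{2m+1}$, $b_0=\frac{2k+1}{2}$, and assume $a_0b_0<1$. Then for every $a,b>0$ with $ab=\frac{2k+1}{2(2m+1)}$ and $b\in\left[b_0-a_0\frac{k-m}{2},\, b_0+a_0\frac{k-m}{2}\right]$, the Gabor system $\mathcal{G}(Q_2,a,b)$ is not a frame for $L^2(\mathbb{R})$. (ii) Let $k,m\in\mathbb{N}$ with $k>m$, and let $a=\frac{1}{2m}$, $b=\frac{2k+1}{2}$ with $ab<1$ and $\gcd(4m,2k+1)=1$. Then $\mathcal{G}(Q_2,a,b)$ is not a frame for $L^2(\mathbb{R})$.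
   Context: A family $\{f_j\}$ in $L^2(\mathbb{R})$ is a frame if there exist $0<A\le B$ with $A\|f\|^2\le\sum_j|\langle f,f_j\rangle|^2\le B\|f\|^2$ for all $f\in L^2(\mathbb{R})$. *)

theory Defs
  imports "HOL-Analysis.Analysis"
begin

definition L2 :: "(real \<Rightarrow> complex) set" where
  "L2 = {f. f \<in> borel_measurable lebesgue \<and> integrable lebesgue (\<lambda>x. (cmod (f x))\<^sup>2)}"

definition L2_inner :: "(real \<Rightarrow> complex) \<Rightarrow> (real \<Rightarrow> complex) \<Rightarrow> complex" where
  "L2_inner f g = (LINT x|lebesgue. f x * cnj (g x))"

definition L2_norm_sq :: "(real \<Rightarrow> complex) \<Rightarrow> real" where
  "L2_norm_sq f = (LINT x|lebesgue. (cmod (f x))\<^sup>2)"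

definition is_frame :: "'i set \<Rightarrow> ('i \<Rightarrow> real \<Rightarrow> complex) \<Rightarrow> bool" where
  "is_frame I F \<longleftrightarrow> (\<forall>i\<in>I. F i \<in> L2) \<and>
     (\<exists>A B. 0 < A \<and> A \<le> B \<and>
       (\<forall>f\<in>L2. (\<lambda>i. (cmod (L2_inner f (F i)))\<^sup>2) summable_on I \<and>
          A * L2_norm_sq f \<le> (\<Sum>\<^sub>\<infinity>i\<in>I. (cmod (L2_inner f (F i)))\<^sup>2) \<and>
          (\<Sum>\<^sub>\<infinity>i\<in>I. (cmod (L2_inner f (F i)))\<^sup>2) \<le> B * L2_norm_sq f))"

definition gabor :: "(real \<Rightarrow> complex) \<Rightarrow> real \<Rightarrow> real \<Rightarrow> int \<times> int \<Rightarrow> real \<Rightarrow> complex" where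
  "gabor g a b = (\<lambda>(l, j) x. exp (2 * of_real pi * \<i> * of_real (b * of_int j * x)) * g (x - a * of_int l))"

definition Q2 :: "real \<Rightarrow> complex" where
  "Q2 x = (if \<bar>x\<bar> \<le> 1 then complex_of_real (1 - \<bar>x\<bar>) else 0)"

end

theory Submission
  imports Defs
begin

text \<open>
  If some nonzero periodic sequence \<open>c\<close> satisfies \<open>\<Sum>\<^sub>k c\<^sub>k g(na + k/b) = 0\<close> for all integers \<open>n\<close>, then
  \<open>\<G>(g,a,b)\<close> has no lower frame bound: test it against sums of short indicators at the points \<open>k/b\<close>
  with coefficients \<open>c\<^sub>k\<close>, cut off by a wide tent.

  For \<open>g = Q\<^sub>2\<close> put \<open>p = 2k+1\<close>, \<open>\<tau> = p/(2b)\<close> and \<open>M = \<tau>/a\<close>, so that \<open>M\<close> is \<open>2m+1\<close> or \<open>2m\<close>, and look for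
  \<open>c\<close> odd and \<open>p\<close>-periodic. Then \<open>f(x) = \<Sum>\<^sub>k c\<^sub>k Q\<^sub>2(x + k/b)\<close> is odd and \<open>2\<tau>\<close>-periodic. The translates of
  \<open>Q\<^sub>2\<close> along \<open>\<tau>\<int>\<close> sum to a constant at all points at distance at least \<open>|1-\<tau>|\<close> from \<open>\<tau>\<int>\<close>, so if \<open>c\<^sub>j\<close> is
  set to \<open>0\<close> for the \<open>j\<close> violating this at some \<open>na + j/b\<close>, then \<open>f(na + \<tau>) = -f(na)\<close> for all \<open>n\<close>.
  Hence \<open>f\<close> vanishes on \<open>a\<int>\<close> as soon as \<open>f(a) = \<dots> = f(ma) = 0\<close>. These are \<open>m\<close> linear equations, and
  more than \<open>m\<close> of the unknowns \<open>c\<^sub>1, \<dots>, c\<^sub>k\<close> remain free.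
\<close>

section \<open>Linear algebra and counting\<close>

text \<open>Gaussian elimination, one equation at a time: an unknown \<open>y\<close> with nonzero
  coefficient in equation \<open>e\<close> is eliminated from the other equations, and its value is
  recovered by back substitution.\<close>

lemma homogeneous_system_nontrivial:
  fixes A :: "'e \<Rightarrow> 'x \<Rightarrow> 'f::field"
  assumes "finite E" "finite X" "card E < card X"
  shows "\<exists>c. (\<exists>x\<in>X. c x \<noteq> 0) \<and> (\<forall>e\<in>E. (\<Sum>x\<in>X. c x * A e x) = 0)"
  using assms
proof (induction E arbitrary: X A rule: finite_induct)
  case empty
  then obtain x where "x \<in> X" by fastforce
  then show ?case by (intro exI[of _ "\<lambda>_. 1"]) auto
next
  case (insert e E)
  show ?case
  proof (cases "\<forall>x\<in>X. A e x = 0")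
    case True
    have "card E < card X" using insert by simp
    then obtain c where "\<exists>x\<in>X. c x \<noteq> 0" "\<forall>e\<in>E. (\<Sum>x\<in>X. c x * A e x) = 0"
      using insert.IH[OF insert.prems(1)] by blast
    with True show ?thesis by (intro exI[of _ c]) auto
  next
    case False
    then obtain y where y: "y \<in> X" "A e y \<noteq> 0" by blast
    define A' where "A' e' x = A e' x - A e' y * A e x / A e y" for e' x
    have "card E < card (X - {y})" using insert y by simp
    then obtain d where d: "\<exists>x\<in>X-{y}. d x \<noteq> 0" "\<forall>e'\<in>E. (\<Sum>x\<in>X-{y}. d x * A' e' x) = 0"
      using insert.IH[of "X - {y}" A'] insert.prems(1) by blast
    define s where "s = (\<Sum>x\<in>X-{y}. d x * A e x)"
    define c where "c = d(y := - s / A e y)"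
    have split: "(\<Sum>x\<in>X. c x * A e' x) = (\<Sum>x\<in>X-{y}. d x * A e' x) - A e' y / A e y * s" for e'
    proof -
      have "(\<Sum>x\<in>X-{y}. c x * A e' x) = (\<Sum>x\<in>X-{y}. d x * A e' x)"
        by (intro sum.cong) (auto simp: c_def)
      then show ?thesis
        using sum.remove[OF insert.prems(1) y(1), of "\<lambda>x. c x * A e' x"] by (simp add: c_def)
    qed
    have "(\<Sum>x\<in>X. c x * A e' x) = (\<Sum>x\<in>X-{y}. d x * A' e' x)" for e'
      unfolding split s_def A'_def sum_distrib_left sum_subtractf[symmetric]
      by (intro sum.cong) (auto simp: algebra_simps)
    moreover have "(\<Sum>x\<in>X. c x * A e x) = 0"
      unfolding split using y by (simp add: s_def)
    moreover have "\<exists>x\<in>X. c x \<noteq> 0" using d(1) by (auto simp: c_def)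
    ultimately show ?thesis using d(2) by (intro exI[of _ c]) auto
  qed
qed

text \<open>With \<open>p = 2k+1\<close> and \<open>M = 2m+1\<close>, an index \<open>j\<close> belongs to the set iff \<open>2j\<close> lies, modulo \<open>p\<close>, within \<open>1/2\<close> of
  some \<open>(2h+1)p / (2M)\<close>. For \<open>h = 0, \<dots>, m\<close> round this number to an integer \<open>s\<close>; since \<open>p\<close> is odd, exactly
  one of \<open>s\<close> and its reflection \<open>p - s\<close> is even, and half of it is the wanted index.\<close>
lemma card_multiples_away_from_zero:
  fixes k m :: nat
  assumes "m < k"
  shows "m < card {j \<in> {1..k}. \<forall>n::int. int k - int m \<le> \<bar>n * int (2*k+1) + 2 * int (2*m+1) * int j\<bar>}"
    (is "m < card ?X")
proof -
  define p M where "p = 2 * int k + 1" and "M = 2 * int m + 1"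
  have pM: "0 < M" "M < p" "odd p" using assms by (auto simp: p_def M_def)
  \<comment> \<open>\<open>s h\<close> is the integer nearest to \<open>(2h+1)p / (2M)\<close>, ties
    being rounded up.\<close>
  define s where "s h = ((2 * int h + 1) * p + M) div (2 * M)" for h
  define J where "J h = nat (if even (s h) then s h div 2 else (p - s h) div 2)" for h
  have s1: "2 * M * s h \<le> (2 * int h + 1) * p + M" for h
    using pM mult_div_mod_eq[of "2 * M" "(2 * int h + 1) * p + M"]
      pos_mod_sign[of "2 * M" "(2 * int h + 1) * p + M"] unfolding s_def by linarith
  have s2: "(2 * int h + 1) * p + M < 2 * M * (s h + 1)" for h
    using pM mult_div_mod_eq[of "2 * M" "(2 * int h + 1) * p + M"]
      pos_mod_bound[of "2 * M" "(2 * int h + 1) * p + M"] unfolding s_def distrib_left by linarith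
  \<comment> \<open>The numbers being rounded grow by \<open>p / M > 1\<close> from one
    \<open>h\<close> to the next.\<close>
  have s_gt: "s h < s h'" if "h < h'" for h h'
  proof -
    have "(2 * int h + 1) * p + 2 * p \<le> (2 * int h' + 1) * p"
      using that pM mult_right_mono[of "2 * int h + 3" "2 * int h' + 1" p] by (simp add: algebra_simps)
    then have "2 * M * s h < 2 * M * s h'"
      using s1[of h] s2[of h'] pM unfolding distrib_left[of "2 * M"] by linarith
    then show ?thesis using pM by simp
  qed
  have s_pos: "1 \<le> s h" for h
  proof -
    have "1 * p \<le> (2 * int h + 1) * p" using pM by (intro mult_right_mono) auto
    then have "2 * M * 1 < 2 * M * (s h + 1)" using s2[of h] pM by linarith
    then show ?thesis using pM by (subst (asm) mult_less_cancel_left_pos) auto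
  qed
  \<comment> \<open>For \<open>h = m\<close> the number is \<open>p / 2 = k + 1/2\<close>, a tie
    rounded up to \<open>k + 1\<close>. All earlier values are below \<open>k\<close>, so no two
    values of \<open>s\<close> add up to \<open>p\<close> and the reflection causes no
    collision.\<close>
  have s_m: "s m = int k + 1"
  proof -
    have "(2 * int m + 1) * p + M = (int k + 1) * (2 * M)" by (simp add: p_def M_def algebra_simps)
    then show ?thesis using pM by (simp add: s_def)
  qed
  have s_less: "s h < int k" if "h < m" for h
  proof -
    have "(2 * int h + 1) * p \<le> (2 * int m - 1) * p" using that pM by (intro mult_right_mono) auto
    moreover have "(2 * int m - 1) * p + M = 2 * M * (int k + 1) - 2 * p"
      by (simp add: p_def M_def algebra_simps)
    ultimately have "2 * M * s h < 2 * M * int k"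
      using s1[of h] pM unfolding distrib_left[of "2 * M"] by linarith
    then show ?thesis using pM by simp
  qed
  have s_le: "s h \<le> int k + 1" if "h \<le> m" for h
    using s_less[of h] s_m that by (cases "h = m") auto
  have twoJ: "2 * int (J h) = (if even (s h) then s h else p - s h)" if "h \<le> m" for h
    using s_pos[of h] s_le[OF that] pM(3) p_def assms by (auto simp: J_def)
  have "inj_on J {..m}"
  proof (rule inj_onI)
    fix h h' assume h: "h \<in> {..m}" "h' \<in> {..m}" and eq: "J h = J h'"
    have "s h = s h' \<or> s h + s h' = p"
      using twoJ[of h] twoJ[of h'] h eq by (auto split: if_splits)
    moreover have "s h + s h' \<noteq> p" if "h \<noteq> h'"
      using that h s_less[of h] s_less[of h'] s_m by (cases "h = m"; cases "h' = m") (auto simp: p_def)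
    ultimately show "h = h'" using s_gt[of h h'] s_gt[of h' h] by (cases h h' rule: linorder_cases) auto
  qed
  moreover have "J ` {..m} \<subseteq> ?X"
  proof safe
    fix h assume h: "h \<le> m"
    show "J h \<in> {1..k}"
      using twoJ[OF h] s_pos[of h] s_le[OF h] assms by (auto simp: p_def split: if_splits)
    fix n :: int
    have odd_mult: "p \<le> \<bar>(2 * i + 1) * p\<bar>" for i :: int
    proof -
      have "1 \<le> \<bar>2 * i + 1\<bar>" by presburger
      then have "1 * p \<le> \<bar>2 * i + 1\<bar> * p" using pM by (intro mult_right_mono) auto
      then show ?thesis using pM by (simp add: abs_mult)
    qed
    have near: "\<bar>(2 * int h + 1) * p - 2 * M * s h\<bar> \<le> M"
      using s1[of h] s2[of h] by (simp add: algebra_simps)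
    \<comment> \<open>This is twice the required bound, as \<open>p - M = 2(k - m)\<close>. The
      number in the modulus differs by at most \<open>M\<close> from an odd multiple of
      \<open>p\<close>; the reflection preserves this because \<open>2Mp\<close> is an even multiple
      of \<open>p\<close>.\<close>
    have "p - M \<le> \<bar>2 * n * p + 2 * M * (2 * int (J h))\<bar>"
    proof (cases "even (s h)")
      case True
      have "2 * n * p + 2 * M * s h = (2 * (n + int h) + 1) * p - ((2 * int h + 1) * p - 2 * M * s h)"
        by (simp add: algebra_simps)
      then show ?thesis using odd_mult[of "n + int h"] near twoJ[OF h] True by simp
    next
      case False
      have "2 * n * p + 2 * M * (p - s h)
          = (2 * (n + M - int h - 1) + 1) * p + ((2 * int h + 1) * p - 2 * M * s h)"
        by (simp add: algebra_simps)
      then show ?thesis using odd_mult[of "n + M - int h - 1"] near twoJ[OF h] False by simp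
    qed
    then show "int k - int m \<le> \<bar>n * int (2*k+1) + 2 * int (2*m+1) * int (J h)\<bar>"
      by (simp add: p_def M_def algebra_simps)
  qed
  ultimately have "card {..m} \<le> card ?X"
    by (intro card_inj_on_le[of J]) auto
  then show ?thesis by simp
qed

section \<open>Periodization\<close>

text \<open>Applied to functions of bounded support, so that each value is a finite sum.\<close>

definition periodization :: "real \<Rightarrow> (real \<Rightarrow> complex) \<Rightarrow> real \<Rightarrow> complex" where
  "periodization T g x = (\<Sum>\<^sub>\<infinity>i::int. g (x + T * of_int i))"

lemma finite_translates:
  fixes T :: real
  assumes "0 < T"
  shows "finite {i::int. \<bar>x + T * of_int i\<bar> < R}"
proof (rule finite_subset)
  show "{i::int. \<bar>x + T * of_int i\<bar> < R} \<subseteq> {\<lfloor>(- R - x) / T\<rfloor>..\<lceil>(R - x) / T\<rceil>}"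
  proof safe
    fix i :: int assume "\<bar>x + T * of_int i\<bar> < R"
    then have "(- R - x) / T < of_int i" "of_int i < (R - x) / T"
      using assms by (auto simp: field_simps)
    then show "i \<in> {\<lfloor>(- R - x) / T\<rfloor>..\<lceil>(R - x) / T\<rceil>}" by (auto simp: floor_le_iff le_ceiling_iff)
  qed
qed simp

lemma summable_on_translates:
  fixes u :: "int \<Rightarrow> complex" and T :: real
  assumes "0 < T" "\<And>x. R \<le> \<bar>x\<bar> \<Longrightarrow> g x = 0"
  shows "(\<lambda>i::int. u i * g (x + T * of_int i)) summable_on UNIV"
  by (rule has_sum_imp_summable,
      rule has_sum_finite_neutralI[where B = "{i. \<bar>x + T * of_int i\<bar> < R}"])
     (use assms finite_translates[OF assms(1), of x R] in auto)

lemma periodization_has_sum: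
  assumes "0 < T" "\<And>x. R \<le> \<bar>x\<bar> \<Longrightarrow> g x = 0"
  shows "((\<lambda>i::int. g (x + T * of_int i)) has_sum periodization T g x) UNIV"
  unfolding periodization_def
  using summable_on_translates[where u = "\<lambda>_. 1" and g = g, OF assms]
  by (intro has_sum_infsum) simp

lemma has_sum_sum:
  fixes F :: "'j \<Rightarrow> 'i \<Rightarrow> 'a::topological_comm_monoid_add"
  assumes "\<And>j. j \<in> X \<Longrightarrow> (F j has_sum S j) A"
  shows "((\<lambda>i. \<Sum>j\<in>X. F j i) has_sum (\<Sum>j\<in>X. S j)) A"
  using assms by (induction X rule: infinite_finite_induct) (auto intro!: has_sum_add)

lemma periodization_shift: "periodization T g (x + T * of_int n) = periodization T g x"
proof -
  have bij: "bij_betw (\<lambda>i::int. i + n) UNIV UNIV"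
    by (rule bij_betwI[of _ _ _ "\<lambda>i. i - n"]) auto
  show ?thesis
    unfolding periodization_def infsum_reindex_bij_betw[OF bij, of "\<lambda>i. g (x + T * of_int i)", symmetric]
    by (simp add: algebra_simps)
qed

lemma periodization_minus:
  assumes "\<And>x. g (- x) = g x"
  shows "periodization T g (- x) = periodization T g x"
proof -
  have bij: "bij_betw (uminus :: int \<Rightarrow> int) UNIV UNIV"
    by (rule bij_betwI[of _ _ _ uminus]) auto
  have "g (- x + T * of_int (- i)) = g (x + T * of_int i)" for i
    using assms[of "x + T * of_int i"] by (simp add: algebra_simps)
  then show ?thesis
    unfolding periodization_def infsum_reindex_bij_betw[OF bij, of "\<lambda>i. g (- x + T * of_int i)", symmetric]
    by simp
qed

text \<open>The class of \<open>j\<close> modulo \<open>p\<close> is parametrized by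
  \<open>j + p i\<close>, which turns the step \<open>\<beta>\<close> into the period
  \<open>p \<beta>\<close>. Sums with \<open>p\<close>-periodic coefficients thereby become
  combinations of periodizations.\<close>

lemma coset_has_sum:
  fixes j :: int
  assumes "0 < \<beta>" "0 < p" "\<And>x. R \<le> \<bar>x\<bar> \<Longrightarrow> g x = 0"
  shows "((\<lambda>k::int. of_bool (int p dvd k - j) * g (x + \<beta> * of_int k))
           has_sum periodization (real p * \<beta>) g (x + \<beta> * of_int j)) UNIV"
proof -
  define h where "h i = j + int p * i" for i
  have "inj h" using assms(2) by (auto simp: h_def inj_on_def)
  have range_h: "range h = {k. int p dvd k - j}"
  proof -
    have "k \<in> range h" if "int p dvd k - j" for k
      using that by (metis (no_types, opaque_lifting) add.commute diff_add_cancel dvdE h_def rangeI)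
    then show ?thesis by (auto simp: h_def)
  qed
  have "(\<lambda>k. g (x + \<beta> * of_int k)) \<circ> h = (\<lambda>i. g (x + \<beta> * of_int j + real p * \<beta> * of_int i))"
    by (auto simp: h_def algebra_simps)
  then have "((\<lambda>k. g (x + \<beta> * of_int k)) has_sum periodization (real p * \<beta>) g (x + \<beta> * of_int j)) (range h)"
    using periodization_has_sum[where T = "real p * \<beta>" and R = R and g = g] assms
    by (simp add: has_sum_reindex[OF \<open>inj h\<close>])
  then show ?thesis
    by (rule has_sum_cong_neutral[THEN iffD1, rotated -1]) (auto simp: range_h)
qed

section \<open>The spline and its periodization\<close>

lemma Q2_eq_0: "1 \<le> \<bar>x\<bar> \<Longrightarrow> Q2 x = 0"
  by (auto simp: Q2_def)

lemma Q2_minus: "Q2 (- x) = Q2 x"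
  by (simp add: Q2_def)

lemma Q2_lipschitz: "cmod (Q2 x - Q2 y) \<le> \<bar>x - y\<bar>"
proof -
  have "Q2 z = of_real (max 0 (1 - \<bar>z\<bar>))" for z by (auto simp: Q2_def max_def)
  then have "cmod (Q2 x - Q2 y) = \<bar>max 0 (1 - \<bar>x\<bar>) - max 0 (1 - \<bar>y\<bar>)\<bar>"
    by (metis norm_of_real of_real_diff real_norm_def)
  then show ?thesis by linarith
qed

text \<open>For \<open>\<tau> = 1\<close> this is the partition of unity.\<close>
lemma periodization_Q2_half_shift:
  assumes "0 < \<tau>" and away: "\<And>i::int. \<bar>1 - \<tau>\<bar> \<le> \<bar>y + \<tau> * of_int i\<bar>"
  shows "periodization (2 * \<tau>) Q2 y + periodization (2 * \<tau>) Q2 (y + \<tau>) = complex_of_real (2 - \<tau>)"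
proof -
  define n where "n = \<lfloor>y / \<tau>\<rfloor>"
  define z where "z = y - \<tau> * of_int n"
  have "of_int n \<le> y / \<tau>" "y / \<tau> < of_int n + 1" by (auto simp: n_def)
  then have z0: "0 \<le> z" "z < \<tau>" using assms(1) by (auto simp: z_def field_simps)
  have z1: "\<bar>1 - \<tau>\<bar> \<le> z" "\<bar>1 - \<tau>\<bar> \<le> \<tau> - z"
    using away[of "- n"] away[of "- n - 1"] z0 by (auto simp: z_def algebra_simps)
  have single: "periodization (2 * \<tau>) Q2 x = Q2 x" if "1 \<le> 2 * \<tau> + x" "1 \<le> 2 * \<tau> - x" for x
  proof -
    have "Q2 (x + 2 * \<tau> * of_int i) = 0" if "i \<noteq> 0" for i :: int
    proof (rule Q2_eq_0)
      consider "1 \<le> i" | "i \<le> -1" using \<open>i \<noteq> 0\<close> by linarith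
      then show "1 \<le> \<bar>x + 2 * \<tau> * of_int i\<bar>"
      proof cases
        case 1
        then have "2 * \<tau> * 1 \<le> 2 * \<tau> * of_int i" using assms(1) by (intro mult_left_mono) auto
        then show ?thesis using \<open>1 \<le> 2 * \<tau> + x\<close> by linarith
      next
        case 2
        then have "2 * \<tau> * of_int i \<le> 2 * \<tau> * (-1)" using assms(1) by (intro mult_left_mono) auto
        then show ?thesis using \<open>1 \<le> 2 * \<tau> - x\<close> by linarith
      qed
    qed
    then show ?thesis
      unfolding periodization_def
      by (intro infsumI has_sum_finite_neutralI[where B = "{0}"]) auto
  qed
  \<comment> \<open>The bounds on \<open>z\<close> leave one translate in each periodization, with
    peaks at \<open>0\<close> and \<open>\<tau>\<close> on either side of \<open>z\<close>. Their
    slopes cancel: \<open>(1 - z) + (1 - (\<tau> - z)) = 2 - \<tau>\<close>.\<close>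
  have base: "periodization (2 * \<tau>) Q2 z + periodization (2 * \<tau>) Q2 (z - \<tau>) = complex_of_real (2 - \<tau>)"
  proof -
    have "periodization (2 * \<tau>) Q2 z = Q2 z" "periodization (2 * \<tau>) Q2 (z - \<tau>) = Q2 (z - \<tau>)"
      using z0 z1 by (auto intro!: single)
    moreover have "Q2 z = of_real (1 - z)" "Q2 (z - \<tau>) = of_real (1 - (\<tau> - z))"
      using z0 z1 by (auto simp: Q2_def)
    ultimately show ?thesis by simp
  qed
  show ?thesis
  \<comment> \<open>Modulo the period \<open>2\<tau>\<close>, a shift by \<open>\<tau>\<close> swaps
    the two summands, so the parity of \<open>n\<close> only decides their order.\<close>
  proof (cases "even n")
    case True
    then obtain h where h: "n = 2 * h" by blast
    have "y = z + 2 * \<tau> * of_int h" "y + \<tau> = z - \<tau> + 2 * \<tau> * of_int (h + 1)"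
      by (auto simp: z_def h algebra_simps)
    then show ?thesis using base by (simp only: periodization_shift)
  next
    case False
    then obtain h where h: "n = 2 * h + 1" by (rule oddE)
    have "y = z - \<tau> + 2 * \<tau> * of_int (h + 1)" "y + \<tau> = z + 2 * \<tau> * of_int (h + 1)"
      by (auto simp: z_def h algebra_simps)
    then show ?thesis using base by (simp only: periodization_shift add.commute)
  qed
qed

text \<open>\<open>c\<close> is built from unknowns \<open>d j\<close>, \<open>j \<in> X\<close>: it
  takes the value \<open>d j\<close> on the class of \<open>j\<close> modulo \<open>p\<close>,
  \<open>- d j\<close> on that of \<open>- j\<close>, and zero elsewhere. The equations at
  \<open>1, ..., m\<close> spread to all \<open>n\<close> through \<open>f(-x) = -f(x)\<close> and,
  on the lattice, \<open>f(x + \<tau>) = -f(x)\<close>.\<close>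

lemma vanishing_combination:
  fixes k m M :: nat and \<tau> :: real and X :: "nat set"
  defines "\<beta> \<equiv> 2 * \<tau> / real (2*k+1)"
  assumes "0 < \<tau>" "0 < m" "M = 2 * m \<or> M = 2 * m + 1" "X \<subseteq> {1..k}" "m < card X"
    and away: "\<And>j n i. j \<in> X \<Longrightarrow> \<bar>1 - \<tau>\<bar> \<le> \<bar>\<tau> / real M * of_int n + \<beta> * real j + \<tau> * of_int i\<bar>"
  obtains c :: "int \<Rightarrow> complex" and z0 where "\<And>z. c (z + int (2*k+1)) = c z" "c z0 \<noteq> 0"
    "\<And>n::int. (\<Sum>\<^sub>\<infinity>z. c z * Q2 (\<tau> / real M * of_int n + \<beta> * of_int z)) = 0"
proof -
  have finX: "finite X" using assms(5) finite_subset by blast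
  define P where "P = periodization (2 * \<tau>) Q2"
  have P_shift: "P (x + 2 * \<tau>) = P x" for x
    using periodization_shift[of "2 * \<tau>" Q2 x 1] by (simp add: P_def)
  have P_minus: "P (- x) = P x" for x
    using periodization_minus[of Q2] Q2_minus by (simp add: P_def)
  define pt where "pt n = \<tau> / real M * of_int n" for n :: int
  have M0: "0 < M" using assms by auto
  obtain d where d: "\<exists>j\<in>X. d j \<noteq> 0"
    "\<forall>n\<in>{1..m}. (\<Sum>j\<in>X. d j * (P (pt (int n) + \<beta> * real j) - P (pt (int n) - \<beta> * real j))) = 0"
    using homogeneous_system_nontrivial[of "{1..m}" X
        "\<lambda>n j. P (pt (int n) + \<beta> * real j) - P (pt (int n) - \<beta> * real j)"] finX assms(6) by auto
  define f where "f x = (\<Sum>j\<in>X. d j * (P (x + \<beta> * real j) - P (x - \<beta> * real j)))" for x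
  have f_minus: "f (- x) = - f x" for x
  proof -
    have "P (- x + \<beta> * real j) = P (x - \<beta> * real j)" "P (- x - \<beta> * real j) = P (x + \<beta> * real j)" for j
      using P_minus[of "x - \<beta> * real j"] P_minus[of "x + \<beta> * real j"] by (simp_all add: algebra_simps)
    then show ?thesis by (auto simp: f_def sum_negf[symmetric] algebra_simps intro!: sum.cong)
  qed
  have f_shift: "f (pt (n + int M)) = - f (pt n)" for n
  proof -
    have pt_shift: "pt (n + int M) = pt n + \<tau>" using M0 by (simp add: pt_def field_simps)
    have const: "P y + P (y + \<tau>) = of_real (2 - \<tau>)" if "\<And>i::int. \<bar>1 - \<tau>\<bar> \<le> \<bar>y + \<tau> * of_int i\<bar>" for y
      unfolding P_def by (rule periodization_Q2_half_shift[OF assms(2) that])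
    \<comment> \<open>The half-shift identity holds at both \<open>pt n + \<beta> j\<close> and
      \<open>pt n - \<beta> j\<close>, and its constant cancels in the difference.\<close>
    have eq: "P (pt n + \<tau> + \<beta> * real j) - P (pt n + \<tau> - \<beta> * real j)
        = - (P (pt n + \<beta> * real j) - P (pt n - \<beta> * real j))" if "j \<in> X" for j
    proof -
      have "P (pt n + \<beta> * real j) + P (pt n + \<beta> * real j + \<tau>) = of_real (2 - \<tau>)"
        by (rule const) (use away[OF that] in \<open>simp add: pt_def\<close>)
      moreover have "P (pt n - \<beta> * real j) + P (pt n - \<beta> * real j + \<tau>) = of_real (2 - \<tau>)"
      proof (rule const)
        fix i :: int
        show "\<bar>1 - \<tau>\<bar> \<le> \<bar>pt n - \<beta> * real j + \<tau> * of_int i\<bar>"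
          using away[OF that, of "- n" "- i"] by (simp add: pt_def algebra_simps abs_minus_commute)
      qed
      ultimately show ?thesis by (simp add: algebra_simps) (metis add_diff_cancel_left' add.commute add_diff_eq)
    qed
    show ?thesis
      unfolding f_def pt_shift sum_negf[symmetric]
      by (intro sum.cong refl) (metis eq mult_minus_right)
  qed
  have f_small: "f (pt (int n)) = 0" if "n \<le> m" for n
  proof (cases "n = 0")
    case True
    have "f 0 = 0" using f_minus[of 0] by simp
    then show ?thesis using True by (simp add: pt_def)
  next
    case False
    then show ?thesis using d(2) that by (simp add: f_def)
  qed
  have f_pt: "f (pt n) = 0" for n
  proof -
    define r where "r = nat (n mod int M)"
    have r: "int r = n mod int M" "r < M" using M0 by (auto simp: r_def nat_less_iff)
    \<comment> \<open>For \<open>m < r < M\<close> the two antisymmetries combine to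
      \<open>f(pt r) = f(pt (M - r))\<close>, and \<open>M - r \<le> m\<close> because
      \<open>M \<le> 2m+1\<close>.\<close>
    have "f (pt (int r)) = 0"
    proof (cases "r \<le> m")
      case False
      have "f (pt (int (M - r))) = 0" using False r assms(4) by (intro f_small) auto
      moreover have "pt (int (M - r)) = - pt (int r - int M)"
        using r by (simp add: pt_def of_nat_diff algebra_simps)
      moreover have "f (pt (int r)) = - f (pt (int r - int M))"
        using f_shift[of "int r - int M"] by simp
      ultimately show ?thesis using f_minus[of "pt (int r - int M)"] by simp
    qed (rule f_small)
    then have "f (pt (int r + i * int M)) = 0" for i :: int
    proof (induction i rule: int_induct[of _ 0])
      case (step1 i)
      then show ?case using f_shift[of "int r + i * int M"] by (simp add: algebra_simps)
    next
      case (step2 i)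
      then show ?case using f_shift[of "int r + (i - 1) * int M"] by (simp add: algebra_simps)
    qed simp
    from this[of "n div int M"] show ?thesis by (simp add: r)
  qed
  define p where "p = 2 * k + 1"
  define c where "c z = (\<Sum>j\<in>X. d j * (of_bool (int p dvd z - int j) - of_bool (int p dvd z - (- int j))))" for z
  have "c (z + int p) = c z" for z
  proof -
    have "int p dvd z + int p - i \<longleftrightarrow> int p dvd z - i" for i
      by (metis add_diff_eq diff_add_eq dvd_add_left_iff dvd_refl)
    from this[of "int _"] this[of "- int _"] show ?thesis by (simp only: c_def)
  qed
  moreover obtain j0 where j0: "j0 \<in> X" "d j0 \<noteq> 0" using d(1) by blast
  \<comment> \<open>Nothing cancels: distinct elements of \<open>{1..k}\<close> are incongruent
    modulo \<open>p\<close>, and \<open>j0\<close> is never congruent to \<open>- j\<close> because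
    \<open>0 < j0 + j \<le> 2k < p\<close>.\<close>
  have "c (int j0) = d j0"
  proof -
    have "of_bool (int p dvd int j0 - int j) - of_bool (int p dvd int j0 - (- int j))
        = (if j = j0 then 1 else (0::complex))" if "j \<in> X" for j
    proof -
      have "j \<in> {1..k}" "j0 \<in> {1..k}" using that j0 assms(5) by auto
      then have "\<not> int p dvd int j0 + int j" "\<bar>int j0 - int j\<bar> < int p"
        using zdvd_not_zless[of "int j0 + int j" "int p"] by (auto simp: p_def)
      moreover from this(2) have "int p dvd int j0 - int j \<Longrightarrow> j = j0"
        using dvd_imp_le_int[of "int j0 - int j" "int p"] by fastforce
      ultimately show ?thesis by auto
    qed
    then have "c (int j0) = (\<Sum>j\<in>X. d j * (if j = j0 then 1 else 0))"
      unfolding c_def by (intro sum.cong) auto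
    then show ?thesis using j0 finX by (simp add: sum.delta' if_distrib cong: if_cong)
  qed
  then have "c (int j0) \<noteq> 0" using j0 by simp
  moreover have "(\<Sum>\<^sub>\<infinity>z. c z * Q2 (x + \<beta> * of_int z)) = f x" for x
  proof (rule infsumI)
    have "0 < \<beta>" "real p * \<beta> = 2 * \<tau>" "0 < p" using assms(2) by (auto simp: \<beta>_def p_def)
    then have coset: "((\<lambda>z. of_bool (int p dvd z - i) * Q2 (x + \<beta> * of_int z)) has_sum P (x + \<beta> * of_int i)) UNIV" for i
      using coset_has_sum[of \<beta> p 1 Q2 i x] Q2_eq_0 by (simp add: P_def)
    have "((\<lambda>z. \<Sum>j\<in>X. d j * (of_bool (int p dvd z - int j) * Q2 (x + \<beta> * of_int z))
          + - d j * (of_bool (int p dvd z - (- int j)) * Q2 (x + \<beta> * of_int z))) has_sum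
        (\<Sum>j\<in>X. d j * P (x + \<beta> * of_int (int j)) + - d j * P (x + \<beta> * of_int (- int j)))) UNIV"
      by (intro has_sum_sum has_sum_add has_sum_cmult_right coset)
    then show "((\<lambda>z. c z * Q2 (x + \<beta> * of_int z)) has_sum f x) UNIV"
      by (simp add: c_def f_def sum_distrib_left sum_distrib_right algebra_simps)
  qed
  then have "(\<Sum>\<^sub>\<infinity>z. c z * Q2 (\<tau> / real M * of_int n + \<beta> * of_int z)) = 0" for n :: int
    using f_pt[of n] by (simp add: pt_def)
  ultimately show ?thesis using that[of c "int j0"] by (simp add: p_def)
qed

section \<open>Inner products with modulated step functions\<close>

text \<open>\<open>P / \<beta>\<close> is the orthogonal projection of \<open>h\<close> onto the
  span of the \<open>e j\<close>, whose common squared norm is \<open>\<beta>\<close>. The squared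
  norm of \<open>h - P / \<beta>\<close> is nonnegative and expands to that of \<open>h\<close>
  minus \<open>S / \<beta>\<close>.\<close>

lemma bessel_inequality:
  fixes e :: "'i \<Rightarrow> 'a \<Rightarrow> complex" and h :: "'a \<Rightarrow> complex"
  assumes "finite J" "0 < \<beta>"
    and hh: "integrable M (\<lambda>x. (cmod (h x))\<^sup>2)"
    and he: "\<And>j. j \<in> J \<Longrightarrow> integrable M (\<lambda>x. h x * cnj (e j x))"
    and ee: "\<And>i j. i \<in> J \<Longrightarrow> j \<in> J \<Longrightarrow>
      has_bochner_integral M (\<lambda>x. e i x * cnj (e j x)) (if i = j then of_real \<beta> else 0)"
  shows "(\<Sum>j\<in>J. (cmod (LINT x|M. h x * cnj (e j x)))\<^sup>2) \<le> \<beta> * (LINT x|M. (cmod (h x))\<^sup>2)"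
proof -
  define \<alpha> where "\<alpha> j = (LINT x|M. h x * cnj (e j x))" for j
  define P where "P x = (\<Sum>j\<in>J. \<alpha> j * e j x)" for x
  define S where "S = (\<Sum>j\<in>J. (cmod (\<alpha> j))\<^sup>2)"
  have hP: "has_bochner_integral M (\<lambda>x. h x * cnj (P x)) (of_real S)"
  proof -
    have "has_bochner_integral M (\<lambda>x. \<Sum>j\<in>J. cnj (\<alpha> j) * (h x * cnj (e j x))) (\<Sum>j\<in>J. cnj (\<alpha> j) * \<alpha> j)"
      unfolding \<alpha>_def
      by (intro has_bochner_integral_sum has_bochner_integral_mult_right has_bochner_integral_integrable he)
    moreover have "(\<Sum>j\<in>J. cnj (\<alpha> j) * \<alpha> j) = of_real S"
      unfolding S_def of_real_sum complex_norm_square by (simp add: mult.commute)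
    ultimately show ?thesis by (simp add: P_def sum_distrib_left mult_ac)
  qed
  have PP: "has_bochner_integral M (\<lambda>x. P x * cnj (P x)) (of_real (\<beta> * S))"
  proof -
    have "has_bochner_integral M (\<lambda>x. \<Sum>i\<in>J. \<Sum>j\<in>J. (\<alpha> i * cnj (\<alpha> j)) * (e i x * cnj (e j x)))
        (\<Sum>i\<in>J. \<Sum>j\<in>J. (\<alpha> i * cnj (\<alpha> j)) * (if i = j then of_real \<beta> else 0))"
      by (intro has_bochner_integral_sum has_bochner_integral_mult_right ee)
    moreover have "(\<Sum>i\<in>J. \<Sum>j\<in>J. (\<alpha> i * cnj (\<alpha> j)) * (if i = j then of_real \<beta> else 0)) = of_real (\<beta> * S)"
      using assms(1)
      unfolding S_def of_real_mult of_real_sum complex_norm_square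
      by (simp add: sum_distrib_left if_distrib sum.delta mult.commute cong: if_cong)
    ultimately show ?thesis by (simp add: P_def sum_product mult_ac)
  qed
  have sq: "of_real ((cmod (h x - P x / of_real \<beta>))\<^sup>2)
      = of_real ((cmod (h x))\<^sup>2) - (h x * cnj (P x)) / of_real \<beta> - cnj (h x * cnj (P x)) / of_real \<beta>
        + (P x * cnj (P x)) / of_real (\<beta>\<^sup>2)" for x
    using assms(2) unfolding complex_norm_square
    by (simp add: field_simps power2_eq_square)
  have "has_bochner_integral M (\<lambda>x. complex_of_real ((cmod (h x - P x / of_real \<beta>))\<^sup>2))
     (of_real (LINT x|M. (cmod (h x))\<^sup>2) - of_real S / of_real \<beta> - cnj (of_real S) / of_real \<beta>
        + of_real (\<beta> * S) / of_real (\<beta>\<^sup>2))"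
    unfolding sq
    by (intro has_bochner_integral_add has_bochner_integral_diff has_bochner_integral_divide
        has_bochner_integral_cnj has_bochner_integral_of_real has_bochner_integral_integrable hh hP PP)
  moreover have "of_real I - of_real S / of_real \<beta> - cnj (of_real S) / of_real \<beta>
      + of_real (\<beta> * S) / of_real (\<beta>\<^sup>2) = complex_of_real (I - S / \<beta>)" for I
    using assms(2) by (simp add: power2_eq_square)
  ultimately have "has_bochner_integral M (\<lambda>x. complex_of_real ((cmod (h x - P x / of_real \<beta>))\<^sup>2))
     (of_real ((LINT x|M. (cmod (h x))\<^sup>2) - S / \<beta>))"
    by (simp only:)
  then have "(LINT x|M. (cmod (h x - P x / of_real \<beta>))\<^sup>2) = (LINT x|M. (cmod (h x))\<^sup>2) - S / \<beta>"
    unfolding has_bochner_integral_iff integral_complex_of_real of_real_eq_iff by blast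
  moreover have "0 \<le> (LINT x|M. (cmod (h x - P x / of_real \<beta>))\<^sup>2)" by simp
  ultimately have "S / \<beta> \<le> (LINT x|M. (cmod (h x))\<^sup>2)" by linarith
  then show ?thesis using assms(2) by (simp add: S_def \<alpha>_def pos_divide_le_eq mult.commute)
qed

section \<open>Modulations on one period\<close>

lemma measurable_cnj [measurable]: "cnj \<in> borel_measurable borel"
  by (intro borel_measurable_continuous_onI continuous_intros)

definition modulation :: "real \<Rightarrow> int \<Rightarrow> real \<Rightarrow> complex" where
  "modulation b j x = exp (2 * of_real pi * \<i> * of_real (b * of_int j * x))"

lemma modulation_eq_cis: "modulation b j x = cis (2 * pi * b * of_int j * x)"
  by (simp add: modulation_def cis_conv_exp mult_ac)

lemma norm_modulation [simp]: "cmod (modulation b j x) = 1"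
  by (simp add: modulation_eq_cis)

lemma measurable_modulation [measurable]: "modulation b j \<in> borel_measurable borel"
  unfolding modulation_def by (intro borel_measurable_continuous_onI continuous_intros)

lemma modulation_mult_cnj: "modulation b i x * cnj (modulation b j x) = modulation b (i - j) x"
  by (simp add: modulation_eq_cis cis_cnj cis_mult algebra_simps)

lemma modulation_shift:
  assumes "b \<noteq> 0"
  shows "modulation b j (x + of_int k / b) = modulation b j x"
proof -
  have "modulation b j (x + of_int k / b) = modulation b j x * cis (2 * pi * of_int (j * k))"
    using assms by (simp add: modulation_eq_cis cis_mult algebra_simps)
  also have "cis (2 * pi * of_int (j * k)) = 1" by (rule cis_multiple_2pi) simp
  finally show ?thesis by simp
qed

text \<open>With \<open>modulation_mult_cnj\<close> this is the orthogonality of the modulations on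
  one period. For \<open>n \<noteq> 0\<close> there is a \<open>1/b\<close>-periodic primitive,
  which takes equal values at both ends.\<close>

lemma modulation_has_integral:
  assumes "0 < b"
  shows "has_bochner_integral lborel (\<lambda>x. indicator {0..1/b} x *\<^sub>R modulation b n x)
    (if n = 0 then of_real (1/b) else 0)"
proof (cases "n = 0")
  case True
  have "has_bochner_integral lborel (\<lambda>x. indicator {0..1/b} x *\<^sub>R (1::complex)) (measure lborel {0..1/b} *\<^sub>R 1)"
    using assms by (intro has_bochner_integral_indicator) auto
  then show ?thesis using assms True by (simp add: modulation_def scaleR_conv_of_real)
next
  case False
  define F where "F x = modulation b n x / (2 * pi * \<i> * b * n)" for x
  have "(F has_vector_derivative modulation b n x) (at x within T)" for x T
    unfolding F_def modulation_def using False assms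
    by (auto intro!: derivative_eq_intros has_vector_derivative_real_field simp: field_simps)
  moreover have "continuous_on {0..1/b} (modulation b n)"
    unfolding modulation_def by (intro continuous_intros)
  ultimately have "has_bochner_integral lborel (\<lambda>x. indicator {0..1/b} x *\<^sub>R modulation b n x) (F (1/b) - F 0)"
    using assms by (intro has_bochner_integral_FTC_Icc) auto
  moreover have "F (1/b) = F 0" using modulation_shift[of b n 0 1] assms by (simp add: F_def)
  ultimately show ?thesis using False by simp
qed

lemma integrable_bounded_support:
  fixes f :: "real \<Rightarrow> 'b::{banach, second_countable_topology}"
  assumes [measurable]: "f \<in> borel_measurable borel"
    and "\<And>x. norm (f x) \<le> B * indicator {u..v} x"
  shows "integrable lborel f"
proof (rule Bochner_Integration.integrable_bound[where f = "\<lambda>x. B * indicator {u..v} x"])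
  show "AE x in lborel. norm (f x) \<le> norm (B * indicator {u..v} x)"
    using assms(2) by (auto intro: order_trans[OF _ abs_ge_self])
qed (auto simp: emeasure_lborel_Icc_eq less_top)

text \<open>As \<open>h\<close> lives on \<open>[0, \<epsilon>]\<close>, inside one period, cutting
  the modulations off outside \<open>[0, 1/b]\<close> leaves the inner products unchanged and makes
  them orthogonal. The short support gives the factor \<open>\<epsilon>\<close>.\<close>

lemma bessel_modulation:
  fixes h :: "real \<Rightarrow> complex"
  assumes "0 < b" "0 \<le> \<epsilon>" "\<epsilon> \<le> 1/b" "finite J"
    and [measurable]: "h \<in> borel_measurable borel"
    and bound: "\<And>x. cmod (h x) \<le> B * indicator {0..\<epsilon>} x"
  shows "(\<Sum>j\<in>J. (cmod (LINT x|lborel. h x * cnj (modulation b j x)))\<^sup>2) \<le> \<epsilon> / b * B\<^sup>2"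
proof -
  define e where "e j x = indicator {0..1/b} x *\<^sub>R modulation b j x" for j x
  have e_meas [measurable]: "e j \<in> borel_measurable borel" for j unfolding e_def by measurable
  have he: "h x * cnj (e j x) = h x * cnj (modulation b j x)" for j x
    using bound[of x] assms(3) by (auto simp: e_def split: split_indicator)
  have bound2: "(cmod (h x))\<^sup>2 \<le> B\<^sup>2 * indicator {0..\<epsilon>} x" for x
    using power_mono[OF bound[of x], of 2] by (auto split: split_indicator simp: power_mult_distrib)
  have int_h: "integrable lborel (\<lambda>x. (cmod (h x))\<^sup>2)"
    by (rule integrable_bounded_support[where B = "B\<^sup>2" and u = 0 and v = \<epsilon>]) (use bound2 in auto)
  have "(\<Sum>j\<in>J. (cmod (LINT x|lborel. h x * cnj (e j x)))\<^sup>2) \<le> 1/b * (LINT x|lborel. (cmod (h x))\<^sup>2)"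
  proof (rule bessel_inequality)
    show "integrable lborel (\<lambda>x. h x * cnj (e j x))" for j
      unfolding he
      by (rule integrable_bounded_support[where B = B and u = 0 and v = \<epsilon>])
        (use bound in \<open>simp_all add: norm_mult\<close>)
    show "has_bochner_integral lborel (\<lambda>x. e i x * cnj (e j x)) (if i = j then of_real (1/b) else 0)" for i j
    proof -
      have "e i x * cnj (e j x) = indicator {0..1/b} x *\<^sub>R modulation b (i - j) x" for x
        by (auto simp: e_def modulation_mult_cnj split: split_indicator)
      then show ?thesis using modulation_has_integral[OF assms(1), of "i - j"] by simp
    qed
  qed (use assms int_h in auto)
  also have "\<dots> \<le> 1/b * (LINT x|lborel. B\<^sup>2 * indicator {0..\<epsilon>} x)"
    by (intro mult_left_mono integral_mono[OF int_h])
      (use bound2 assms(1) in \<open>auto simp: emeasure_lborel_Icc_eq less_top\<close>)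
  also have "\<dots> = \<epsilon> / b * B\<^sup>2" using assms(2) by simp
  finally show ?thesis unfolding he .
qed

section \<open>Step functions on short intervals along a lattice\<close>

definition step_function :: "real \<Rightarrow> real \<Rightarrow> (int \<Rightarrow> complex) \<Rightarrow> int set \<Rightarrow> real \<Rightarrow> complex" where
  "step_function \<beta> \<epsilon> v K x = (\<Sum>k\<in>K. v k * indicator {\<beta> * of_int k..<\<beta> * of_int k + \<epsilon>} x)"

lemma measurable_step_function [measurable]: "step_function \<beta> \<epsilon> v K \<in> borel_measurable borel"
  unfolding step_function_def by measurable

text \<open>Since \<open>\<epsilon> \<le> \<beta>\<close>, the half-open intervals are disjoint:
  only \<open>k = \<lfloor>x / \<beta>\<rfloor>\<close> can contribute, so the square has no cross
  terms.\<close>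

lemma norm_step_function_sq:
  assumes "finite K" "0 < \<beta>" "\<epsilon> \<le> \<beta>"
  shows "(cmod (step_function \<beta> \<epsilon> v K x))\<^sup>2
    = (\<Sum>k\<in>K. (cmod (v k))\<^sup>2 * indicator {\<beta> * of_int k..<\<beta> * of_int k + \<epsilon>} x)"
proof -
  define k0 where "k0 = \<lfloor>x / \<beta>\<rfloor>"
  have "k = k0" if "x \<in> {\<beta> * of_int k..<\<beta> * of_int k + \<epsilon>}" for k :: int
  proof -
    have "of_int k \<le> x / \<beta>" "x / \<beta> < of_int k + 1" using that assms by (auto simp: field_simps)
    then show ?thesis unfolding k0_def by linarith
  qed
  then have ind: "indicator {\<beta> * of_int k..<\<beta> * of_int k + \<epsilon>} x
      = (if k = k0 then indicator {\<beta> * of_int k0..<\<beta> * of_int k0 + \<epsilon>} x else (0::'b::zero_neq_one))" for k :: int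
    by (auto split: split_indicator)
  show ?thesis
    unfolding step_function_def
    by (subst (1 2) ind) (auto simp: assms(1) if_distrib sum.delta norm_mult power_mult_distrib
        split: split_indicator cong: if_cong)
qed

lemma step_function_L2:
  assumes "finite K" "0 < \<epsilon>" "\<epsilon> \<le> \<beta>"
  shows "step_function \<beta> \<epsilon> v K \<in> L2"
    and "L2_norm_sq (step_function \<beta> \<epsilon> v K) = \<epsilon> * (\<Sum>k\<in>K. (cmod (v k))\<^sup>2)"
proof -
  have int: "has_bochner_integral lborel (\<lambda>x. (cmod (step_function \<beta> \<epsilon> v K x))\<^sup>2)
      (\<Sum>k\<in>K. (cmod (v k))\<^sup>2 * measure lborel {\<beta> * of_int k..<\<beta> * of_int k + \<epsilon>})"
    unfolding norm_step_function_sq[OF assms(1) less_le_trans[OF assms(2,3)] assms(3)]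
    by (intro has_bochner_integral_sum has_bochner_integral_mult_right has_bochner_integral_real_indicator)
       (use assms in auto)
  \<comment> \<open>\<open>L2\<close> refers to the completed measure; for Borel functions its
    integrals agree with those over \<open>lborel\<close>.\<close>
  have meas: "(\<lambda>x. (cmod (step_function \<beta> \<epsilon> v K x))\<^sup>2) \<in> borel_measurable lborel" by measurable
  show "step_function \<beta> \<epsilon> v K \<in> L2"
    using int integrable_completion[OF meas] measurable_completion[of "step_function \<beta> \<epsilon> v K" lborel borel]
    by (simp add: L2_def has_bochner_integral_iff)
  show "L2_norm_sq (step_function \<beta> \<epsilon> v K) = \<epsilon> * (\<Sum>k\<in>K. (cmod (v k))\<^sup>2)"
    using int assms(2)
    by (simp add: L2_norm_sq_def integral_completion[OF meas] has_bochner_integral_iff sum_distrib_left mult.commute)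
qed

text \<open>The modulations are \<open>1/b\<close>-periodic, so the inner product folds onto one period.\<close>
lemma L2_inner_step_function_gabor:
  fixes g :: "real \<Rightarrow> complex"
  assumes "finite K" "0 < b" and contg: "continuous_on UNIV g"
  shows "L2_inner (step_function (1/b) \<epsilon> v K) (gabor g a b (l, j))
    = (LINT y|lborel. (indicator {0..<\<epsilon>} y * (\<Sum>k\<in>K. v k * cnj (g (y + of_int k / b - a * of_int l))))
        * cnj (modulation b j y))"
proof -
  have [measurable]: "g \<in> borel_measurable borel" by (rule borel_measurable_continuous_onI[OF contg])
  define G where "G k x = (indicator {of_int k / b..<of_int k / b + \<epsilon>} x :: complex)
     * (cnj (g (x - a * of_int l)) * cnj (modulation b j x))" for k :: int and x
  have gab: "gabor g a b (l, j) x = modulation b j x * g (x - a * of_int l)" for x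
    by (simp add: gabor_def modulation_def)
  have shift: "G k (of_int k / b + y)
      = indicator {0..<\<epsilon>} y * cnj (g (y + of_int k / b - a * of_int l)) * cnj (modulation b j y)" for k y
    using modulation_shift[of b j y k] assms(2)
    by (auto simp: G_def add.commute split: split_indicator)
  have intG: "integrable lborel (G k)" for k
  proof -
    have "continuous_on {of_int k / b..of_int k / b + \<epsilon>} (\<lambda>x. cnj (g (x - a * of_int l)) * cnj (modulation b j x))"
      unfolding modulation_def
      by (intro continuous_intros continuous_on_compose2[OF contg]) auto
    from borel_integrable_atLeastAtMost'[OF this]
    have "set_integrable lborel {of_int k / b..<of_int k / b + \<epsilon>}
        (\<lambda>x. cnj (g (x - a * of_int l)) * cnj (modulation b j x))"
      by (rule set_integrable_subset) auto
    then show ?thesis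
      unfolding set_integrable_def G_def by (simp add: scaleR_conv_of_real of_real_indicator)
  qed
  have intG': "integrable lborel (\<lambda>y. G k (of_int k / b + y))" for k
    using lborel_integrable_real_affine[OF intG[of k], of 1 "of_int k / b"] by simp
  have "L2_inner (step_function (1/b) \<epsilon> v K) (gabor g a b (l, j)) = (LINT x|lborel. (\<Sum>k\<in>K. v k * G k x))"
    unfolding L2_inner_def gab
    by (subst integral_completion)
      (auto simp: step_function_def G_def sum_distrib_left sum_distrib_right mult_ac
        intro!: Bochner_Integration.integral_cong sum.cong)
  also have "\<dots> = (\<Sum>k\<in>K. v k * (LINT x|lborel. G k x))"
    using intG by (simp add: Bochner_Integration.integral_sum)
  also have "\<dots> = (\<Sum>k\<in>K. v k * (LINT y|lborel. G k (of_int k / b + y)))"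
    by (intro sum.cong refl arg_cong2[where f = "(*)"])
       (subst lborel_integral_real_affine[where c = 1 and t = "of_int _ / b"], auto)
  also have "\<dots> = (LINT y|lborel. (\<Sum>k\<in>K. v k * G k (of_int k / b + y)))"
    using intG' by (simp add: Bochner_Integration.integral_sum)
  finally show ?thesis
    by (simp add: shift sum_distrib_right sum_distrib_left mult_ac)
qed

section \<open>Absence of a lower frame bound\<close>

text \<open>For fixed \<open>l\<close> the coefficients are inner products of the modulations with
  \<open>H l\<close>, which is supported in \<open>[0, \<epsilon>]\<close> and bounded by
  \<open>B\<close>. Bessel's inequality bounds their sum over \<open>j\<close>, however many
  \<open>j\<close> occur, and only \<open>l \<in> L\<close> contribute.\<close>

lemma gabor_coefficients_step_function_bound:
  fixes g :: "real \<Rightarrow> complex" and L :: "int set"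
  assumes "0 < b" "0 < \<epsilon>" "\<epsilon> \<le> 1/b" "finite K" "finite L" "finite F"
    and contg: "continuous_on UNIV g"
    and small: "\<And>l y. 0 \<le> y \<Longrightarrow> y \<le> \<epsilon> \<Longrightarrow>
      cmod (\<Sum>k\<in>K. v k * cnj (g (y + of_int k / b - a * of_int l))) \<le> B"
    and zero: "\<And>l y. l \<notin> L \<Longrightarrow> 0 \<le> y \<Longrightarrow> y \<le> \<epsilon> \<Longrightarrow>
      (\<Sum>k\<in>K. v k * cnj (g (y + of_int k / b - a * of_int l))) = 0"
  shows "(\<Sum>i\<in>F. (cmod (L2_inner (step_function (1/b) \<epsilon> v K) (gabor g a b i)))\<^sup>2)
    \<le> real (card L) * (\<epsilon> / b * B\<^sup>2)"
proof -
  define Q where "Q i = (cmod (L2_inner (step_function (1/b) \<epsilon> v K) (gabor g a b i)))\<^sup>2" for i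
  define H where "H l y = indicator {0..<\<epsilon>} y * (\<Sum>k\<in>K. v k * cnj (g (y + of_int k / b - a * of_int l)))" for l y
  define J where "J = snd ` F"
  have finJ: "finite J" using assms by (simp add: J_def)
  have [measurable]: "g \<in> borel_measurable borel" by (rule borel_measurable_continuous_onI[OF contg])
  have Q_eq: "Q (l, j) = (cmod (LINT y|lborel. H l y * cnj (modulation b j y)))\<^sup>2" for l j
    unfolding Q_def H_def by (subst L2_inner_step_function_gabor[OF assms(4,1) contg]) simp
  have "0 \<le> B" using order_trans[OF norm_ge_zero small[of 0 0]] assms(2) by simp
  have Q_L: "(\<Sum>j\<in>J. Q (l, j)) \<le> \<epsilon> / b * B\<^sup>2" for l
    unfolding Q_eq
  proof (rule bessel_modulation)
    show "H l \<in> borel_measurable borel" unfolding H_def by measurable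
    show "cmod (H l x) \<le> B * indicator {0..\<epsilon>} x" for x
      using small[of x l] \<open>0 \<le> B\<close> by (auto simp: H_def norm_mult split: split_indicator)
  qed (use assms finJ in auto)
  have Q_0: "Q (l, j) = 0" if "l \<notin> L" for l j
  proof -
    have "H l y = 0" for y
      using zero[OF that, of y] by (auto simp: H_def split: split_indicator)
    then show ?thesis by (simp add: Q_eq)
  qed
  \<comment> \<open>Enlarging \<open>F\<close> to a product set separates the sums over
    \<open>l\<close> and \<open>j\<close>.\<close>
  have "sum Q F \<le> sum Q ((fst ` F \<union> L) \<times> J)"
    using assms(5,6) finJ by (intro sum_mono2) (auto simp: Q_def J_def image_iff, (metis fst_conv snd_conv)+)
  also have "\<dots> = (\<Sum>l\<in>fst ` F \<union> L. \<Sum>j\<in>J. Q (l, j))"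
    by (simp add: sum.cartesian_product)
  also have "\<dots> = (\<Sum>l\<in>L. \<Sum>j\<in>J. Q (l, j))"
    using assms(5,6) by (intro sum.mono_neutral_right) (auto simp: Q_0)
  also have "\<dots> \<le> (\<Sum>l\<in>L. \<epsilon> / b * B\<^sup>2)" by (intro sum_mono Q_L)
  finally show ?thesis by (simp add: Q_def)
qed

section \<open>Cutting off a periodic sequence by a tent\<close>

definition tent :: "nat \<Rightarrow> int \<Rightarrow> real" where
  "tent J k = max 0 (1 - \<bar>of_int k\<bar> / real J)"

lemma tent_bounds: "0 \<le> tent J k" "tent J k \<le> 1"
  by (auto simp: tent_def)

lemma tent_eq_0: "0 < J \<Longrightarrow> int J \<le> \<bar>k\<bar> \<Longrightarrow> tent J k = 0"
  by (auto simp: tent_def field_simps)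

lemma tent_diff: "0 < J \<Longrightarrow> \<bar>tent J k - tent J k'\<bar> \<le> \<bar>of_int k - of_int k'\<bar> / real J"
proof -
  assume "0 < J"
  have "\<bar>\<bar>of_int k\<bar> / real J - \<bar>of_int k'\<bar> / real J\<bar> = \<bar>\<bar>of_int k\<bar> - \<bar>of_int k'\<bar>\<bar> / real J"
    by (simp add: diff_divide_distrib[symmetric])
  also have "\<dots> \<le> \<bar>of_int k - of_int k'\<bar> / real J" by (intro divide_right_mono) auto
  finally show ?thesis unfolding tent_def by linarith
qed

context
  fixes g :: "real \<Rightarrow> complex" and c :: "int \<Rightarrow> complex" and b R C G D u y :: real and J :: nat and q :: int
  assumes b: "0 < b" and J: "0 < J" and y: "0 \<le> y" "y \<le> 1 / (b * real J)"
    and lip: "\<And>x y. cmod (g x - g y) \<le> C * \<bar>x - y\<bar>"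
    and supp: "\<And>x. R \<le> \<bar>x\<bar> \<Longrightarrow> g x = 0"
    and q: "R * b + 2 \<le> of_int q" "0 \<le> q"
begin

text \<open>The last index with \<open>k / b + u \<le> 0\<close>; only indices within
  \<open>q\<close> of it can meet the support of \<open>g\<close>.\<close>

private definition "k0 = \<lfloor>- u * b\<rfloor>"

text \<open>The slack of 2 in \<open>q\<close> covers the rounding in \<open>k0\<close> and the
  shift by \<open>t * b \<le> 1\<close>.\<close>

private lemma far:
  assumes "k \<notin> {k0 - q..k0 + q}" "0 \<le> t" "t \<le> 1 / b"
  shows "g (t + of_int k / b + u) = 0"
proof (rule supp)
  have k0: "of_int k0 \<le> - u * b" "- u * b < of_int k0 + 1" by (simp_all add: k0_def)
  have t: "0 \<le> t * b" "t * b \<le> 1" using assms(2,3) b by (auto simp: field_simps)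
  have "q + 1 \<le> \<bar>k - k0\<bar>" using assms(1) by auto
  then have "of_int q + 1 \<le> \<bar>real_of_int k - of_int k0\<bar>" by linarith
  then have "R * b \<le> \<bar>t * b + of_int k + u * b\<bar>" using k0 t q by linarith
  also have "\<dots> = \<bar>t + of_int k / b + u\<bar> * b"
    using b abs_mult[of "t + of_int k / b + u" b] by (simp add: algebra_simps)
  finally show "R \<le> \<bar>t + of_int k / b + u\<bar>" using b by simp
qed

private lemma y_le: "y \<le> 1 / b"
proof -
  have "1 / (b * real J) \<le> 1 / b" using b J by (intro divide_left_mono) auto
  then show ?thesis using y by simp
qed

text \<open>Both sides equal the sum over the union of the two ranges: outside the first the tent
  vanishes, outside the second \<open>g\<close> does. The new range has \<open>2q+1\<close> indices
  whatever \<open>J\<close> is.\<close>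

private lemma tent_sum_eq:
  "(\<Sum>k\<in>{- int J..int J}. (of_real (tent J k) * c k) * cnj (g (y + of_int k / b + u)))
    = (\<Sum>k\<in>{k0 - q..k0 + q}. (of_real (tent J k) * c k) * cnj (g (y + of_int k / b + u)))"
proof -
  let ?t = "\<lambda>k. (of_real (tent J k) * c k) * cnj (g (y + of_int k / b + u))"
  have "sum ?t {- int J..int J} = sum ?t ({- int J..int J} \<union> {k0 - q..k0 + q})"
    using J by (intro sum.mono_neutral_left) (auto simp: tent_eq_0)
  also have "\<dots> = sum ?t {k0 - q..k0 + q}"
    using far y_le y by (intro sum.mono_neutral_right) auto
  finally show ?thesis .
qed

lemma tent_sum_eq_0:
  assumes "int J + q \<le> \<bar>\<lfloor>- u * b\<rfloor>\<bar>"
  shows "(\<Sum>k\<in>{- int J..int J}. (of_real (tent J k) * c k) * cnj (g (y + of_int k / b + u))) = 0"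
  unfolding tent_sum_eq
proof (rule sum.neutral, rule ballI)
  fix k assume "k \<in> {k0 - q..k0 + q}"
  then have "int J \<le> \<bar>k\<bar>" using assms unfolding k0_def[symmetric] atLeastAtMost_iff by linarith
  then show "(of_real (tent J k) * c k) * cnj (g (y + of_int k / b + u)) = 0"
    using J by (simp add: tent_eq_0)
qed

text \<open>By the vanishing hypothesis one may subtract the value of the tent at a fixed nearby index, so
  only the variation of the tent and of \<open>g\<close> enters.\<close>
lemma tent_sum_bound:
  assumes vanish: "(\<Sum>\<^sub>\<infinity>k. c k * cnj (g (of_int k / b + u))) = 0"
    and c_bound: "\<And>k. cmod (c k) \<le> D" and g_bound: "\<And>x. cmod (g x) \<le> G"
  shows "cmod (\<Sum>k\<in>{- int J..int J}. (of_real (tent J k) * c k) * cnj (g (y + of_int k / b + u)))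
    \<le> (2 * of_int q + 1) * D * (of_int q * G + C / b) / real J"
proof -
  define S where "S = {k0 - q..k0 + q}"
  have "((\<lambda>k. c k * cnj (g (of_int k / b + u))) has_sum (\<Sum>k\<in>S. c k * cnj (g (of_int k / b + u)))) UNIV"
    by (rule has_sum_finite_neutralI[where B = S])
      (use far[of _ 0] b in \<open>auto simp: S_def\<close>)
  from infsumI[OF this] have van: "(\<Sum>k\<in>S. c k * cnj (g (of_int k / b + u))) = 0"
    using vanish by simp
  have "D \<ge> 0" "G \<ge> 0"
    using order_trans[OF norm_ge_zero c_bound[of 0]] order_trans[OF norm_ge_zero g_bound[of 0]] .
  have "C \<ge> 0" using order_trans[OF norm_ge_zero lip[of 0 1]] by simp
  let ?d = "\<lambda>k. of_real (tent J k) * cnj (g (y + of_int k / b + u)) - of_real (tent J k0) * cnj (g (of_int k / b + u))"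
  have "(\<Sum>k\<in>{- int J..int J}. (of_real (tent J k) * c k) * cnj (g (y + of_int k / b + u)))
      = (\<Sum>k\<in>S. (of_real (tent J k) * c k) * cnj (g (y + of_int k / b + u)))
        - of_real (tent J k0) * (\<Sum>k\<in>S. c k * cnj (g (of_int k / b + u)))"
    using van unfolding tent_sum_eq by (simp add: S_def)
  also have "\<dots> = (\<Sum>k\<in>S. c k * ?d k)"
    by (simp add: sum_distrib_left sum_subtractf algebra_simps)
  also have "cmod \<dots> \<le> (\<Sum>k\<in>S. D * ((of_int q * G + C / b) / real J))"
  proof (rule sum_norm_le)
    fix k assume "k \<in> S"
    \<comment> \<open>The first part is the variation of \<open>g\<close> over a distance
      \<open>y\<close>, at most \<open>C / (b J)\<close>; the second is the variation of the tent
      across the window, at most \<open>q / J\<close>, times \<open>G\<close>.\<close>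
    have "?d k = of_real (tent J k) * cnj (g (y + of_int k / b + u) - g (of_int k / b + u))
        + of_real (tent J k - tent J k0) * cnj (g (of_int k / b + u))"
      by (simp add: algebra_simps)
    also have "cmod \<dots> \<le> tent J k * cmod (g (y + of_int k / b + u) - g (of_int k / b + u))
        + \<bar>tent J k - tent J k0\<bar> * cmod (g (of_int k / b + u))"
      by (rule order_trans[OF norm_triangle_ineq])
        (simp only: norm_mult norm_of_real complex_mod_cnj abs_of_nonneg[OF tent_bounds(1)] order_refl)
    also have "\<dots> \<le> 1 * (C * (1 / (b * real J))) + (of_int q / real J) * G"
    proof (intro add_mono mult_mono)
      have "cmod (g (y + of_int k / b + u) - g (of_int k / b + u)) \<le> C * y"
        using lip[of "y + of_int k / b + u" "of_int k / b + u"] y by simp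
      also have "\<dots> \<le> C * (1 / (b * real J))" using y \<open>C \<ge> 0\<close> by (intro mult_left_mono)
      finally show "cmod (g (y + of_int k / b + u) - g (of_int k / b + u)) \<le> C * (1 / (b * real J))" .
      have "\<bar>real_of_int k - of_int k0\<bar> \<le> of_int q" using \<open>k \<in> S\<close> by (auto simp: S_def)
      then show "\<bar>tent J k - tent J k0\<bar> \<le> of_int q / real J"
        using tent_diff[OF J, of k k0] by (meson divide_right_mono of_nat_0_le_iff order_trans)
    qed (use tent_bounds g_bound q J b \<open>C \<ge> 0\<close> in auto)
    also have "\<dots> = (of_int q * G + C / b) / real J" by (simp add: add_divide_distrib)
    finally show "cmod (c k * ?d k) \<le> D * ((of_int q * G + C / b) / real J)"
      unfolding norm_mult using c_bound \<open>D \<ge> 0\<close> by (intro mult_mono) auto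
  qed
  also have "\<dots> = (2 * of_int q + 1) * D * (of_int q * G + C / b) / real J"
    using q(2) by (simp add: S_def)
  finally show ?thesis .
qed

end

lemma periodic_int_mult:
  fixes c :: "int \<Rightarrow> 'a"
  assumes "\<And>z. c (z + p) = c z"
  shows "c (z + p * i) = c z"
proof (induction i rule: int_induct[of _ 0])
  case (step1 i)
  then show ?case using assms[of "z + p * i"] by (simp add: algebra_simps)
next
  case (step2 i)
  then show ?case using assms[of "z + p * (i - 1)"] by (simp add: algebra_simps)
qed simp

text \<open>\<open>N\<close> indices of the class of \<open>z0\<close> modulo \<open>p\<close> lie
  in \<open>[0, p N]\<close>, the inner half of the tent's right side, where the tent is at least
  \<open>1/2\<close>.\<close>

lemma sum_tent_sq_lower:
  fixes c :: "int \<Rightarrow> complex" and p N :: nat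
  assumes "0 < p" "\<And>z. c (z + int p) = c z"
  shows "real N * (cmod (c z0))\<^sup>2 / 4
    \<le> (\<Sum>k\<in>{- int (2*p*N)..int (2*p*N)}. (cmod (of_real (tent (2*p*N) k) * c k))\<^sup>2)"
proof -
  define z1 where "z1 = z0 mod int p"
  have z1: "0 \<le> z1" "z1 < int p" using assms(1) by (auto simp: z1_def)
  have c_z1: "c (z1 + int p * i) = c z0" for i
    using periodic_int_mult[of c "int p" z1, OF assms(2)] periodic_int_mult[of c "int p" z1 "z0 div int p", OF assms(2)]
    by (simp add: z1_def)
  define h where "h i = z1 + int p * int i" for i :: nat
  have h: "0 \<le> h i" "h i \<le> int (p * N)" if "i < N" for i
  proof -
    have "int p * int i + int p \<le> int p * int N"
      using that assms(1) mult_left_mono[of "int i + 1" "int N" "int p"] by (simp add: algebra_simps)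
    then show "0 \<le> h i" "h i \<le> int (p * N)" using z1 by (auto simp: h_def)
  qed
  have "inj_on h {..<N}" using assms(1) by (auto simp: h_def inj_on_def)
  have "real N * (cmod (c z0))\<^sup>2 / 4 = (\<Sum>i<N. (1/2 * cmod (c z0))\<^sup>2)"
    by (simp add: power_divide)
  also have "\<dots> \<le> (\<Sum>i<N. (cmod (of_real (tent (2*p*N) (h i)) * c (h i)))\<^sup>2)"
  proof (intro sum_mono power_mono)
    fix i assume "i \<in> {..<N}"
    then have i: "i < N" by simp
    have "real_of_int (h i) \<le> real_of_int (int (p * N))" using h(2)[OF i] of_int_le_iff by blast
    then have "1/2 \<le> tent (2*p*N) (h i)"
      using h(1)[OF i] i assms(1) by (auto simp: tent_def field_simps max_def)
    then show "1/2 * cmod (c z0) \<le> cmod (of_real (tent (2*p*N) (h i)) * c (h i))"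
      using c_z1[of "int i"] mult_right_mono[of "1/2" "tent (2*p*N) (h i)" "cmod (c z0)"]
      by (simp add: norm_mult h_def tent_bounds)
  qed auto
  also have "\<dots> = (\<Sum>k\<in>h ` {..<N}. (cmod (of_real (tent (2*p*N) k) * c k))\<^sup>2)"
    using \<open>inj_on h {..<N}\<close> by (simp add: sum.reindex)
  also have "\<dots> \<le> (\<Sum>k\<in>{- int (2*p*N)..int (2*p*N)}. (cmod (of_real (tent (2*p*N) k) * c k))\<^sup>2)"
  proof (intro sum_mono2 subsetI)
    fix k assume "k \<in> h ` {..<N}"
    then obtain i where "i < N" "k = h i" by blast
    then show "k \<in> {- int (2*p*N)..int (2*p*N)}" using h[of i] by auto
  qed auto
  finally show ?thesis .
qed

text \<open>A scaling argument with \<open>J = 2pN\<close>: the test function has squared norm at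
  least \<open>\<epsilon> \<gamma> N\<close>, while \<open>O(J)\<close> translations contribute at
  most \<open>\<epsilon> / b * (E / J)^2\<close> each. A lower frame bound \<open>A\<close> would
  therefore keep \<open>N \<gamma> A\<close> bounded.\<close>

theorem not_frame_if_translates_dependent:
  fixes g :: "real \<Rightarrow> complex" and c :: "int \<Rightarrow> complex" and a b C R :: real and p :: nat
  assumes ab: "0 < a" "0 < b" "0 < p"
    and lip: "\<And>x y. cmod (g x - g y) \<le> C * \<bar>x - y\<bar>"
    and supp: "\<And>x. R \<le> \<bar>x\<bar> \<Longrightarrow> g x = 0"
    and per: "\<And>z. c (z + int p) = c z" and nz: "c z0 \<noteq> 0"
    and vanish: "\<And>n::int. (\<Sum>\<^sub>\<infinity>k. c k * cnj (g (a * of_int n + of_int k / b))) = 0"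
  shows "\<not> is_frame UNIV (gabor g a b)"
proof
  assume "is_frame UNIV (gabor g a b)"
  then obtain A where A: "0 < A" and frame: "\<And>f. f \<in> L2 \<Longrightarrow>
      (\<lambda>i. (cmod (L2_inner f (gabor g a b i)))\<^sup>2) summable_on UNIV \<and>
      A * L2_norm_sq f \<le> (\<Sum>\<^sub>\<infinity>i. (cmod (L2_inner f (gabor g a b i)))\<^sup>2)"
    unfolding is_frame_def by blast
  have C: "0 \<le> C" using order_trans[OF norm_ge_zero lip[of 0 1]] by simp
  have contg: "continuous_on UNIV g"
    by (rule lipschitz_on_continuous_on[of C]) (use lip C in \<open>auto simp: lipschitz_on_def dist_norm\<close>)
  \<comment> \<open>For \<open>|x| < R\<close>, compare \<open>g x\<close> with the zero of
    \<open>g\<close> at \<open>R\<close>, at distance at most \<open>2|R|\<close>.\<close>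
  define G where "G = C * (2 * \<bar>R\<bar>)"
  have g_bound: "cmod (g x) \<le> G" for x
  proof (cases "R \<le> \<bar>x\<bar>")
    case True
    then show ?thesis using supp C by (simp add: G_def)
  next
    case False
    have "cmod (g x) \<le> C * \<bar>x - R\<bar>" using lip[of x R] supp[of R] by simp
    also have "\<dots> \<le> G" unfolding G_def using False C by (intro mult_left_mono) auto
    finally show ?thesis .
  qed
  define D where "D = (\<Sum>r\<in>{0..<int p}. cmod (c r))"
  have c_bound: "cmod (c k) \<le> D" for k
  proof -
    have "c k = c (k mod int p)"
      using periodic_int_mult[of c "int p" "k mod int p" "k div int p", OF per] by simp
    then show ?thesis unfolding D_def using ab(3) by (auto intro!: member_le_sum)
  qed
  define q where "q = max 0 \<lceil>R * b + 2\<rceil>"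
  have q: "R * b + 2 \<le> of_int q" "0 \<le> q" unfolding q_def by linarith+
  \<comment> \<open>\<open>E / J\<close> will bound the folded sums and \<open>E' * J\<close> the
    number of relevant translations; the 3 in \<open>E'\<close> accounts for \<open>l = 0\<close>
    and the rounding in \<open>t\<close>.\<close>
  define E where "E = (2 * of_int q + 1) * D * (of_int q * G + C / b)"
  define E' where "E' = 2 * (of_int q + 2) / (a * b) + 3"
  define \<gamma> where "\<gamma> = (cmod (c z0))\<^sup>2 / 4"
  have pos: "0 < \<gamma>" "0 \<le> E'" using nz q ab by (auto simp: \<gamma>_def E'_def)
  obtain N :: nat where N: "E' * E\<^sup>2 / b / (\<gamma> * A) < real N" using reals_Archimedean2 by blast
  moreover have "0 \<le> E' * E\<^sup>2 / b / (\<gamma> * A)" using pos A ab by simp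
  ultimately have N0: "0 < N" by linarith
  define J where "J = 2 * p * N"
  have J: "0 < J" using N0 ab by (simp add: J_def)
  \<comment> \<open>With this width \<open>g\<close> varies by at most \<open>C / (b J)\<close> on
    each interval, the same order as the variation of the tent.\<close>
  define \<epsilon> where "\<epsilon> = 1 / (b * real J)"
  have \<epsilon>: "0 < \<epsilon>" "\<epsilon> \<le> 1 / b" using ab J by (auto simp: \<epsilon>_def intro!: divide_left_mono)
  define v where "v k = of_real (tent J k) * c k" for k
  define K where "K = {- int J..int J}"
  \<comment> \<open>For \<open>|l| > t\<close> the window around
    \<open>\<lfloor>a l b\<rfloor>\<close> misses the support of the tent; the extra 1 pays for the
    floor.\<close>
  define t where "t = \<lceil>(real J + of_int q + 1) / (a * b)\<rceil>"
  define L where "L = {- t..t}"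
  have small: "cmod (\<Sum>k\<in>K. v k * cnj (g (y + of_int k / b - a * of_int l))) \<le> E / real J"
    if "0 \<le> y" "y \<le> \<epsilon>" for l :: int and y
  proof -
    have "(\<Sum>\<^sub>\<infinity>k. c k * cnj (g (of_int k / b + - a * of_int l))) = 0"
      using vanish[of "- l"] by (simp add: add.commute)
    from tent_sum_bound[OF ab(2) J that(1) _ lip supp q this c_bound g_bound] that(2)
    show ?thesis by (simp add: \<epsilon>_def v_def K_def E_def)
  qed
  have zero: "(\<Sum>k\<in>K. v k * cnj (g (y + of_int k / b - a * of_int l))) = 0"
    if "l \<notin> L" "0 \<le> y" "y \<le> \<epsilon>" for l :: int and y
  proof -
    have "t < \<bar>l\<bar>" using that(1) by (auto simp: L_def)
    then have "(real J + of_int q + 1) / (a * b) < \<bar>of_int l\<bar>" unfolding t_def by linarith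
    then have "real J + of_int q + 1 < \<bar>of_int l\<bar> * (a * b)" using ab by (simp add: pos_divide_less_eq)
    also have "\<dots> = \<bar>- (- a * of_int l) * b\<bar>" using ab by (simp add: abs_mult)
    finally have "int J + q \<le> \<bar>\<lfloor>- (- a * of_int l) * b\<rfloor>\<bar>" by linarith
    from tent_sum_eq_0[OF ab(2) J that(2) _ lip supp q this] that(3)
    show ?thesis by (simp add: \<epsilon>_def v_def K_def)
  qed
  let ?f = "step_function (1/b) \<epsilon> v K"
  have f: "?f \<in> L2" "L2_norm_sq ?f = \<epsilon> * (\<Sum>k\<in>K. (cmod (v k))\<^sup>2)"
    using step_function_L2[of K \<epsilon> "1/b" v] \<epsilon> by (auto simp: K_def)
  have card_L: "real (card L) \<le> E' * real J"
  proof -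
    have "0 \<le> (real J + of_int q + 1) / (a * b)" using q ab by simp
    then have "0 \<le> t" unfolding t_def by linarith
    then have "real (card L) = 2 * of_int t + 1" by (simp add: L_def)
    also have "\<dots> \<le> 2 * ((real J + of_int q + 1) / (a * b)) + 3" unfolding t_def by linarith
    also have "\<dots> \<le> 2 * (((of_int q + 2) * real J) / (a * b)) + 3 * real J"
    proof -
      have "1 \<le> real J" using J by linarith
      moreover have "of_int q * 1 \<le> of_int q * real J" using calculation q by (intro mult_left_mono) auto
      ultimately have "real J + of_int q + 1 \<le> (of_int q + 2) * real J" by (simp add: algebra_simps)
      then show ?thesis using \<open>1 \<le> real J\<close> ab by (intro add_mono mult_left_mono divide_right_mono) auto
    qed
    also have "\<dots> = E' * real J" by (simp add: E'_def algebra_simps add_divide_distrib)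
    finally show ?thesis .
  qed
  have "A * (\<epsilon> * (real N * \<gamma>)) \<le> A * L2_norm_sq ?f"
    unfolding f(2) using sum_tent_sq_lower[OF ab(3), of c N z0, OF per] A \<epsilon>
    by (intro mult_left_mono) (auto simp: K_def v_def J_def \<gamma>_def)
  also have "\<dots> \<le> (\<Sum>\<^sub>\<infinity>i. (cmod (L2_inner ?f (gabor g a b i)))\<^sup>2)" using frame[OF f(1)] by simp
  also have "\<dots> \<le> real (card L) * (\<epsilon> / b * (E / real J)\<^sup>2)"
    by (intro infsum_le_finite_sums gabor_coefficients_step_function_bound)
      (use frame[OF f(1)] small zero ab \<epsilon> contg in \<open>auto simp: K_def L_def\<close>)
  also have "\<dots> \<le> E' * real J * (\<epsilon> / b * (E / real J)\<^sup>2)"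
    using card_L ab \<epsilon> by (intro mult_right_mono) auto
  also have "\<dots> = \<epsilon> * (E' * E\<^sup>2 / b / real J)"
    using J by (simp add: field_simps power2_eq_square)
  finally have "A * (real N * \<gamma>) \<le> E' * E\<^sup>2 / b / real J"
    unfolding mult.left_commute[of A \<epsilon>] using \<epsilon>(1) by (rule mult_left_le_imp_le)
  also have "\<dots> \<le> E' * E\<^sup>2 / b / 1"
    using J pos ab by (intro divide_left_mono) auto
  finally have "real N * (\<gamma> * A) \<le> E' * E\<^sup>2 / b" by (simp add: mult_ac)
  then have "real N \<le> E' * E\<^sup>2 / b / (\<gamma> * A)"
    using A pos by (subst pos_le_divide_eq) auto
  then show False using N by simp
qed

section \<open>The second order B-spline\<close>

text \<open>\<open>away\<close> is the distance condition of \<open>vanishing_combination\<close>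
  multiplied by \<open>2b\<close>: the points in question are \<open>z / (2bM)\<close> with integers
  \<open>z\<close>, and \<open>1 - \<tau> = (2b - p) / (2b)\<close>.\<close>

lemma gabor_Q2_not_frame:
  fixes k m M :: nat and a b :: real and X :: "nat set"
  assumes "0 < b" "0 < m" "M = 2 * m \<or> M = 2 * m + 1" "a * b = real (2*k+1) / (2 * real M)"
    and X: "X \<subseteq> {1..k}" "m < card X"
    and away: "\<And>j n. j \<in> X \<Longrightarrow>
      \<bar>2 * b - real (2*k+1)\<bar> \<le> \<bar>of_int (n * int (2*k+1) + 2 * int M * int j)\<bar> / real M"
  shows "\<not> is_frame UNIV (gabor Q2 a b)"
proof -
  define p where "p = 2 * k + 1"
  define \<tau> where "\<tau> = real p / (2 * b)"
  have pos: "0 < real p" "0 < real M" "0 < \<tau>" using assms by (auto simp: \<tau>_def p_def)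
  have a: "a = \<tau> / real M" using assms(1,4) pos by (simp add: \<tau>_def p_def field_simps)
  then have a0: "0 < a" using pos by simp
  have \<beta>: "2 * \<tau> / real (2*k+1) = 1 / b"
    using pos(1) unfolding \<tau>_def p_def[symmetric] by simp
  have near: "\<bar>1 - \<tau>\<bar> \<le> \<bar>\<tau> / real M * of_int n + 2 * \<tau> / real (2*k+1) * real j + \<tau> * of_int i\<bar>"
    if "j \<in> X" for j and n i :: int
  proof -
    \<comment> \<open>Since \<open>\<tau> = M a\<close>, a translation by \<open>\<tau> i\<close> is
      absorbed by replacing \<open>n\<close> with \<open>n + i M\<close>.\<close>
    define z where "z = (n + i * int M) * int (2*k+1) + 2 * int M * int j"
    have "\<tau> / real M * of_int n + 2 * \<tau> / real (2*k+1) * real j + \<tau> * of_int i = of_int z / real M / (2 * b)"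
      unfolding \<beta> using assms(1) pos by (simp add: \<tau>_def z_def p_def field_simps)
    then have "\<bar>\<tau> / real M * of_int n + 2 * \<tau> / real (2*k+1) * real j + \<tau> * of_int i\<bar>
        = \<bar>of_int z\<bar> / real M / (2 * b)"
      using assms(1) by simp
    moreover have "\<bar>1 - \<tau>\<bar> = \<bar>2 * b - real (2*k+1)\<bar> / (2 * b)"
    proof -
      have "1 - \<tau> = (2 * b - real (2*k+1)) / (2 * b)"
        using assms(1) by (simp add: \<tau>_def p_def field_simps)
      then show ?thesis using assms(1) by simp
    qed
    moreover have "\<bar>2 * b - real (2*k+1)\<bar> / (2 * b) \<le> \<bar>of_int z\<bar> / real M / (2 * b)"
      unfolding z_def using assms(1) by (intro divide_right_mono away that) auto
    ultimately show ?thesis by simp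
  qed
  obtain c z0 where c: "\<And>z. c (z + int (2*k+1)) = c z" "c z0 \<noteq> (0::complex)"
    "\<And>n::int. (\<Sum>\<^sub>\<infinity>z. c z * Q2 (\<tau> / real M * of_int n + 2 * \<tau> / real (2*k+1) * of_int z)) = 0"
    by (rule vanishing_combination[OF pos(3) assms(2,3) X], erule near, rule that)
  have cnj_Q2: "cnj (Q2 x) = Q2 x" for x by (simp add: Q2_def)
  show ?thesis
  proof (rule not_frame_if_translates_dependent[where C = 1 and R = 1 and c = c and p = "2 * k + 1"])
    show "(\<Sum>\<^sub>\<infinity>z. c z * cnj (Q2 (a * of_int n + of_int z / b))) = 0" for n :: int
      using c(3)[of n] unfolding cnj_Q2 a \<beta> by simp
  qed (use c a0 assms(1) Q2_lipschitz Q2_eq_0 in auto)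
qed

theorem theorem1p3:
  shows "(\<forall>(k::nat) (m::nat) (a::real) (b::real).
            0 < m \<and> m < k \<and>
            (1 / real (2*m+1)) * (real (2*k+1) / 2) < 1 \<and>
            0 < a \<and> 0 < b \<and> a * b = real (2*k+1) / (2 * real (2*m+1)) \<and>
            real (2*k+1) / 2 - (1 / real (2*m+1)) * (real k - real m) / 2 \<le> b \<and>
            b \<le> real (2*k+1) / 2 + (1 / real (2*m+1)) * (real k - real m) / 2
          \<longrightarrow> \<not> is_frame UNIV (gabor Q2 a b))
       \<and> (\<forall>(k::nat) (m::nat).
            0 < m \<and> m < k \<and>
            (1 / real (2*m)) * (real (2*k+1) / 2) < 1 \<and>
            gcd (4*m) (2*k+1) = 1
          \<longrightarrow> \<not> is_frame UNIV (gabor Q2 (1 / real (2*m)) (real (2*k+1) / 2)))"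
proof (intro conjI allI impI; elim conjE)
  fix k m :: nat and a b :: real
  assume mk: "0 < m" "m < k" and ab: "0 < b" "a * b = real (2*k+1) / (2 * real (2*m+1))"
    and b: "real (2*k+1) / 2 - (1 / real (2*m+1)) * (real k - real m) / 2 \<le> b"
      "b \<le> real (2*k+1) / 2 + (1 / real (2*m+1)) * (real k - real m) / 2"
  \<comment> \<open>The interval for \<open>b\<close>, doubled. Its radius
    \<open>(k - m) / (2m+1)\<close> is what the counting lemma provides after division by
    \<open>M\<close>.\<close>
  have b_near: "\<bar>2 * b - real (2*k+1)\<bar> \<le> (real k - real m) / real (2*m+1)"
  proof -
    define r \<delta> where "r = real (2*k+1)" and "\<delta> = (real k - real m) / real (2*m+1)"
    have "r / 2 - \<delta> / 2 \<le> b" "b \<le> r / 2 + \<delta> / 2"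
      using b unfolding r_def \<delta>_def by (simp_all only: times_divide_eq_left mult_1)
    then have "\<bar>2 * b - r\<bar> \<le> \<delta>" by linarith
    then show ?thesis by (simp only: r_def \<delta>_def)
  qed
  let ?X = "{j \<in> {1..k}. \<forall>n::int. int k - int m \<le> \<bar>n * int (2*k+1) + 2 * int (2*m+1) * int j\<bar>}"
  show "\<not> is_frame UNIV (gabor Q2 a b)"
  proof (rule gabor_Q2_not_frame[where X = ?X and M = "2 * m + 1", OF ab(1) mk(1) _ ab(2)])
    show "m < card ?X" by (rule card_multiples_away_from_zero[OF mk(2)])
    fix j n assume "j \<in> ?X"
    then have "int k - int m \<le> \<bar>n * int (2*k+1) + 2 * int (2*m+1) * int j\<bar>" by blast
    then have "real_of_int (int k - int m) \<le> real_of_int \<bar>n * int (2*k+1) + 2 * int (2*m+1) * int j\<bar>"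
      by (simp only: of_int_le_iff)
    then have "(real k - real m) / real (2*m+1)
        \<le> \<bar>of_int (n * int (2*k+1) + 2 * int (2*m+1) * int j)\<bar> / real (2*m+1)"
      by (intro divide_right_mono) auto
    with b_near show "\<bar>2 * b - real (2*k+1)\<bar>
        \<le> \<bar>of_int (n * int (2*k+1) + 2 * int (2*m+1) * int j)\<bar> / real (2*m+1)"
      by (rule order_trans)
  qed auto
next
  fix k m :: nat
  assume mk: "0 < m" "m < k"
  show "\<not> is_frame UNIV (gabor Q2 (1 / real (2*m)) (real (2*k+1) / 2))"
  \<comment> \<open>Here \<open>2b = 2k+1\<close>, that is \<open>\<tau> = 1\<close>, so the
    distance condition is void and all \<open>k > m\<close> indices are available.\<close>
  proof (rule gabor_Q2_not_frame[where X = "{1..k}" and M = "2 * m"])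
    have "2 * (real (2*k+1) / 2) - real (2*k+1) = 0" by simp
    then show "\<bar>2 * (real (2*k+1) / 2) - real (2*k+1)\<bar>
        \<le> \<bar>of_int (n * int (2*k+1) + 2 * int (2*m) * int j)\<bar> / real (2*m)" for j :: nat and n :: int
      by (simp only:) simp
  qed (use mk in auto)
qed

end
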